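(* Let $\mathbf{T}=(T,m,e)$ be an opmonoidal monad on a monoidal category $(\mathbb{V},\otimes,\mathbb{I})$, with structure $\chi_{V,W}:T(V\otimes W)\to T(V)\otimes T(W)$ and $\theta:T(\mathbb{I})\to\mathbb{I}$. Then $\mathbf{T}$ is a right pre-Hopf monad if and only if $\mathbf{T}$ is $\mathbf{G}_{T(\mathbf{I})}$-Galois.
   Context: Monoidal categories are taken to be strict. An opmonoidal monad on $\mathbb{V}$ is a monad $(T,m,e)$ together with a natural transformation $\chi_{V,W}:T(V\otimes W)\to T(V)\otimes T(W)$ and a morphism $\theta:T(\mathbb{I})\to\mathbb{I}$ such that $(\chi_{U,V}\otimes T(W))\chi_{U\otimes V,W}=(T(U)\otimes\chi_{V,W})\chi_{U,V\otimes W}$, $(\theta\otimes T(V))\chi_{\mathbb{I},V}=1=(T(V)\otimes\theta)\chi_{V,\mathbb{I}}$, $\chi_{V,W}m_{V\otimes W}=(m_V\otimes m_W)\chi_{T(V),T(W)}T(\chi_{V,W})$, $\theta m_{\mathbb{I}}=\theta T(\theta)$, $\chi_{V,W}e_{V\otimes W}=e_V\otimes e_W$, $\theta e_{\mathbb{I}}=1$. $\mathbf{T}$ is right pre-Hopf if for every $V\in\mathbb{V}$ the morphism $H^r_{V,\mathbb{I}}:TT(V)=T(T(V)\otimes\mathbb{I})\xrightarrow{\chi_{T(V),\mathbb{I}}}TT(V)\otimes T(\mathbb{I})\xrightarrow{m_V\otimes T(\mathbb{I})}T(V)\otimes T(\mathbb{I})$ is an isomorphism. $T(\mathbf{I})=(T(\mathbb{I}),\chi_{\mathbb{I},\mathbb{I}},\theta)$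 is a comonoid in $\mathbb{V}$, and $\mathbf{G}_{T(\mathbf{I})}$ is the induced comonad on $\mathbb{V}$ with functor part $-\otimes T(\mathbb{I})$. For a comonad $\mathbf{G}=(G,\delta,\varepsilon)$ on $\mathbb{V}$, a left $\mathbf{G}$-comodule structure on the functor $T$ is a natural transformation $\beta:T\to GT$ with $\varepsilon T\cdot\beta=1$ and $\delta T\cdot\beta=G\beta\cdot\beta$. The monad $\mathbf{T}$ is called $\mathbf{G}$-Galois if there is a left $\mathbf{G}$-comodule structure $\beta:T\to GT$ on the functor $T$ such that the composite $TT\xrightarrow{\beta T}GTT\xrightarrow{Gm}GT$ is an isomorphism.
   Formalization: With an arbitrary comodule structure β, Galois does not imply right pre-Hopf (T=H⊗−, H=k[{1,0}], char k≠2); the equivalence is proved for Galois with respect to β=χ_{−,I}, plus right pre-Hopf implies Galois for some β. *)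

theory Defs
  imports Main
begin

section \<open>Categories, endofunctors and natural transformations\<close>

text \<open>Objects and arrows are given by carrier sets; nothing is assumed about
  the operations outside the carriers. \<open>g \<cdot> f\<close> is \<open>g\<close> after \<open>f\<close>.\<close>

record ('o, 'a) cat =
  Obj :: "'o set"
  Arr :: "'a set"
  Dom :: "'a \<Rightarrow> 'o"
  Cod :: "'a \<Rightarrow> 'o"
  Id :: "'o \<Rightarrow> 'a"
  Comp :: "'a \<Rightarrow> 'a \<Rightarrow> 'a" (infixr "\<cdot>\<index>" 60)

definition Hom :: "('o, 'a, 'z) cat_scheme \<Rightarrow> 'o \<Rightarrow> 'o \<Rightarrow> 'a set" where
  "Hom C X Y = {f \<in> Arr C. Dom C f = X \<and> Cod C f = Y}"

locale category =
  fixes C :: "('o, 'a, 'z) cat_scheme" (structure)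
  assumes Dom_in: "f \<in> Arr C \<Longrightarrow> Dom C f \<in> Obj C"
    and Cod_in: "f \<in> Arr C \<Longrightarrow> Cod C f \<in> Obj C"
    and Id_in: "X \<in> Obj C \<Longrightarrow> Id C X \<in> Hom C X X"
    and Comp_in: "\<lbrakk>f \<in> Hom C X Y; g \<in> Hom C Y Z\<rbrakk> \<Longrightarrow> g \<cdot> f \<in> Hom C X Z"
    and Comp_Id_right: "f \<in> Hom C X Y \<Longrightarrow> f \<cdot> Id C X = f"
    and Comp_Id_left: "f \<in> Hom C X Y \<Longrightarrow> Id C Y \<cdot> f = f"
    and Comp_assoc: "\<lbrakk>f \<in> Hom C W X; g \<in> Hom C X Y; h \<in> Hom C Y Z\<rbrakk>
      \<Longrightarrow> (h \<cdot> g) \<cdot> f = h \<cdot> (g \<cdot> f)"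

definition iso :: "('o, 'a, 'z) cat_scheme \<Rightarrow> 'a \<Rightarrow> bool" where
  "iso C f \<longleftrightarrow> (\<exists>X Y g. f \<in> Hom C X Y \<and> g \<in> Hom C Y X \<and>
     g \<cdot>\<^bsub>C\<^esub> f = Id C X \<and> f \<cdot>\<^bsub>C\<^esub> g = Id C Y)"

record ('o, 'a) ftor =
  fob :: "'o \<Rightarrow> 'o"
  far :: "'a \<Rightarrow> 'a"

definition id_ftor :: "('o, 'a) ftor" where
  "id_ftor = \<lparr>fob = (\<lambda>X. X), far = (\<lambda>f. f)\<rparr>"

definition comp_ftor :: "('o, 'a) ftor \<Rightarrow> ('o, 'a) ftor \<Rightarrow> ('o, 'a) ftor" (infixr "\<circ>\<^sub>F" 60) where
  "F \<circ>\<^sub>F G = \<lparr>fob = (\<lambda>X. fob F (fob G X)), far = (\<lambda>f. far F (far G f))\<rparr>"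

locale endofunctor = category C
  for C :: "('o, 'a, 'z) cat_scheme" (structure) +
  fixes F :: "('o, 'a) ftor"
  assumes fob_in: "X \<in> Obj C \<Longrightarrow> fob F X \<in> Obj C"
    and far_in: "f \<in> Hom C X Y \<Longrightarrow> far F f \<in> Hom C (fob F X) (fob F Y)"
    and far_Id: "X \<in> Obj C \<Longrightarrow> far F (Id C X) = Id C (fob F X)"
    and far_Comp: "\<lbrakk>f \<in> Hom C X Y; g \<in> Hom C Y Z\<rbrakk> \<Longrightarrow> far F (g \<cdot> f) = far F g \<cdot> far F f"

definition nat_trans ::
  "('o, 'a, 'z) cat_scheme \<Rightarrow> ('o, 'a) ftor \<Rightarrow> ('o, 'a) ftor \<Rightarrow> ('o \<Rightarrow> 'a) \<Rightarrow> bool" where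
  "nat_trans C F G \<tau> \<longleftrightarrow>
     (\<forall>X\<in>Obj C. \<tau> X \<in> Hom C (fob F X) (fob G X)) \<and>
     (\<forall>X\<in>Obj C. \<forall>Y\<in>Obj C. \<forall>f\<in>Hom C X Y. \<tau> Y \<cdot>\<^bsub>C\<^esub> far F f = far G f \<cdot>\<^bsub>C\<^esub> \<tau> X)"

definition nat_iso ::
  "('o, 'a, 'z) cat_scheme \<Rightarrow> ('o, 'a) ftor \<Rightarrow> ('o, 'a) ftor \<Rightarrow> ('o \<Rightarrow> 'a) \<Rightarrow> bool" where
  "nat_iso C F G \<tau> \<longleftrightarrow> nat_trans C F G \<tau> \<and>
     (\<exists>\<sigma>. nat_trans C G F \<sigma> \<and>
        (\<forall>X\<in>Obj C. \<sigma> X \<cdot>\<^bsub>C\<^esub> \<tau> X = Id C (fob F X) \<and> \<tau> X \<cdot>\<^bsub>C\<^esub> \<sigma> X = Id C (fob G X)))"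

section \<open>Monads, comonads and Galois monads\<close>

record ('o, 'a) monad =
  mfun :: "('o, 'a) ftor"
  mult :: "'o \<Rightarrow> 'a"
  munit :: "'o \<Rightarrow> 'a"

locale monad = endofunctor C "mfun M"
  for C :: "('o, 'a, 'z) cat_scheme" (structure) and M :: "('o, 'a, 'y) monad_scheme" +
  assumes mult_nat: "nat_trans C (mfun M \<circ>\<^sub>F mfun M) (mfun M) (mult M)"
    and munit_nat: "nat_trans C id_ftor (mfun M) (munit M)"
    and mult_assoc: "X \<in> Obj C \<Longrightarrow>
      mult M X \<cdot> far (mfun M) (mult M X) = mult M X \<cdot> mult M (fob (mfun M) X)"
    and mult_unit_left: "X \<in> Obj C \<Longrightarrow>
      mult M X \<cdot> munit M (fob (mfun M) X) = Id C (fob (mfun M) X)"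
    and mult_unit_right: "X \<in> Obj C \<Longrightarrow>
      mult M X \<cdot> far (mfun M) (munit M X) = Id C (fob (mfun M) X)"

record ('o, 'a) comonad =
  gfun :: "('o, 'a) ftor"
  comult :: "'o \<Rightarrow> 'a"
  counit :: "'o \<Rightarrow> 'a"

locale comonad = endofunctor C "gfun G"
  for C :: "('o, 'a, 'z) cat_scheme" (structure) and G :: "('o, 'a) comonad" +
  assumes comult_nat: "nat_trans C (gfun G) (gfun G \<circ>\<^sub>F gfun G) (comult G)"
    and counit_nat: "nat_trans C (gfun G) id_ftor (counit G)"
    and comult_coassoc: "X \<in> Obj C \<Longrightarrow>
      far (gfun G) (comult G X) \<cdot> comult G X = comult G (fob (gfun G) X) \<cdot> comult G X"
    and comult_counit_left: "X \<in> Obj C \<Longrightarrow>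
      counit G (fob (gfun G) X) \<cdot> comult G X = Id C (fob (gfun G) X)"
    and comult_counit_right: "X \<in> Obj C \<Longrightarrow>
      far (gfun G) (counit G X) \<cdot> comult G X = Id C (fob (gfun G) X)"

text \<open>A left \<open>G\<close>-comodule structure \<open>\<beta> : T \<rightarrow> GT\<close> on a functor \<open>T\<close>:
  \<open>\<epsilon>T \<cdot> \<beta> = 1\<close> and \<open>\<delta>T \<cdot> \<beta> = G\<beta> \<cdot> \<beta>\<close>.\<close>

definition left_comodule_structure ::
  "('o, 'a, 'z) cat_scheme \<Rightarrow> ('o, 'a) comonad \<Rightarrow> ('o, 'a) ftor \<Rightarrow> ('o \<Rightarrow> 'a) \<Rightarrow> bool" where
  "left_comodule_structure C G T \<beta> \<longleftrightarrow> nat_trans C T (gfun G \<circ>\<^sub>F T) \<beta> \<and>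
     (\<forall>X\<in>Obj C. counit G (fob T X) \<cdot>\<^bsub>C\<^esub> \<beta> X = Id C (fob T X)) \<and>
     (\<forall>X\<in>Obj C. comult G (fob T X) \<cdot>\<^bsub>C\<^esub> \<beta> X = far (gfun G) (\<beta> X) \<cdot>\<^bsub>C\<^esub> \<beta> X)"

text \<open>The composite \<open>Gm \<cdot> \<beta>T : TT \<rightarrow> GTT \<rightarrow> GT\<close>.\<close>

definition galois_map ::
  "('o, 'a, 'z) cat_scheme \<Rightarrow> ('o, 'a, 'y) monad_scheme \<Rightarrow> ('o, 'a) comonad
    \<Rightarrow> ('o \<Rightarrow> 'a) \<Rightarrow> 'o \<Rightarrow> 'a" where
  "galois_map C M G \<beta> X = far (gfun G) (mult M X) \<cdot>\<^bsub>C\<^esub> \<beta> (fob (mfun M) X)"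

definition Galois_via ::
  "('o, 'a, 'z) cat_scheme \<Rightarrow> ('o, 'a, 'y) monad_scheme \<Rightarrow> ('o, 'a) comonad
    \<Rightarrow> ('o \<Rightarrow> 'a) \<Rightarrow> bool" where
  "Galois_via C M G \<beta> \<longleftrightarrow> left_comodule_structure C G (mfun M) \<beta> \<and>
     nat_iso C (mfun M \<circ>\<^sub>F mfun M) (gfun G \<circ>\<^sub>F mfun M) (galois_map C M G \<beta>)"

text \<open>\<open>Galois\<close> leaves the coaction unspecified, \<open>Galois_via\<close> names it. The two differ for an
  opmonoidal monad \<open>T\<close> and \<open>G = - \<otimes> T(\<one>)\<close>: over a field \<open>k\<close> with \<open>2 \<noteq> 0\<close>, let \<open>H\<close> be the
  bialgebra of the multiplicative monoid \<open>{1, 0}\<close> and \<open>T = H \<otimes> -\<close>. The units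
  \<open>u\<^sub>1 = [1]\<close>, \<open>u\<^sub>0 = [1] - 2[0]\<close> form a basis of \<open>H\<close>, and \<open>u\<^sub>i \<otimes> v \<mapsto> u\<^sub>i \<otimes> v \<otimes> [i]\<close> is a
  coaction whose Galois map \<open>u\<^sub>i \<otimes> h \<otimes> v \<mapsto> u\<^sub>i h \<otimes> v \<otimes> [i]\<close> is invertible, whereas for the
  canonical coaction \<open>\<chi>\<^sub>-\<^sub>,\<^sub>\<one> : [i] \<otimes> v \<mapsto> [i] \<otimes> v \<otimes> [i]\<close> the Galois map is not injective.\<close>

definition Galois ::
  "('o, 'a, 'z) cat_scheme \<Rightarrow> ('o, 'a, 'y) monad_scheme \<Rightarrow> ('o, 'a) comonad \<Rightarrow> bool" where
  "Galois C M G \<longleftrightarrow> (\<exists>\<beta>. Galois_via C M G \<beta>)"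

section \<open>Strict monoidal categories and opmonoidal monads\<close>

record ('o, 'a) moncat = "('o, 'a) cat" +
  Tob :: "'o \<Rightarrow> 'o \<Rightarrow> 'o" (infixr "\<otimes>\<^sub>o\<index>" 70)
  Tar :: "'a \<Rightarrow> 'a \<Rightarrow> 'a" (infixr "\<otimes>\<index>" 70)
  Unit :: "'o" ("\<one>\<index>")

locale strict_monoidal_category = category V
  for V :: "('o, 'a, 'z) moncat_scheme" (structure) +
  assumes Unit_in: "\<one> \<in> Obj V"
    and Tob_in: "\<lbrakk>X \<in> Obj V; Y \<in> Obj V\<rbrakk> \<Longrightarrow> X \<otimes>\<^sub>o Y \<in> Obj V"
    and Tar_in: "\<lbrakk>f \<in> Hom V X X'; g \<in> Hom V Y Y'\<rbrakk>
      \<Longrightarrow> f \<otimes> g \<in> Hom V (X \<otimes>\<^sub>o Y) (X' \<otimes>\<^sub>o Y')"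
    and Tar_Id: "\<lbrakk>X \<in> Obj V; Y \<in> Obj V\<rbrakk> \<Longrightarrow> Id V X \<otimes> Id V Y = Id V (X \<otimes>\<^sub>o Y)"
    and Tar_Comp: "\<lbrakk>f \<in> Hom V X X'; f' \<in> Hom V X' X''; g \<in> Hom V Y Y'; g' \<in> Hom V Y' Y''\<rbrakk>
      \<Longrightarrow> (f' \<cdot> f) \<otimes> (g' \<cdot> g) = (f' \<otimes> g') \<cdot> (f \<otimes> g)"
    and Tob_assoc: "\<lbrakk>X \<in> Obj V; Y \<in> Obj V; Z \<in> Obj V\<rbrakk>
      \<Longrightarrow> (X \<otimes>\<^sub>o Y) \<otimes>\<^sub>o Z = X \<otimes>\<^sub>o (Y \<otimes>\<^sub>o Z)"
    and Tar_assoc: "\<lbrakk>f \<in> Arr V; g \<in> Arr V; h \<in> Arr V\<rbrakk> \<Longrightarrow> (f \<otimes> g) \<otimes> h = f \<otimes> (g \<otimes> h)"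
    and Tob_Unit_left: "X \<in> Obj V \<Longrightarrow> \<one> \<otimes>\<^sub>o X = X"
    and Tob_Unit_right: "X \<in> Obj V \<Longrightarrow> X \<otimes>\<^sub>o \<one> = X"
    and Tar_Unit_left: "f \<in> Arr V \<Longrightarrow> Id V \<one> \<otimes> f = f"
    and Tar_Unit_right: "f \<in> Arr V \<Longrightarrow> f \<otimes> Id V \<one> = f"

record ('o, 'a) opmonad = "('o, 'a) monad" +
  chi :: "'o \<Rightarrow> 'o \<Rightarrow> 'a"
  theta :: "'a"

abbreviation opob :: "('o, 'a, 'y) monad_scheme \<Rightarrow> 'o \<Rightarrow> 'o" where
  "opob T \<equiv> fob (mfun T)"

abbreviation opar :: "('o, 'a, 'y) monad_scheme \<Rightarrow> 'a \<Rightarrow> 'a" where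
  "opar T \<equiv> far (mfun T)"

locale opmonoidal_monad = strict_monoidal_category V + monad V T
  for V :: "('o, 'a, 'z) moncat_scheme" (structure) and T :: "('o, 'a, 'y) opmonad_scheme" +
  assumes chi_in: "\<lbrakk>X \<in> Obj V; Y \<in> Obj V\<rbrakk>
      \<Longrightarrow> chi T X Y \<in> Hom V (opob T (X \<otimes>\<^sub>o Y)) (opob T X \<otimes>\<^sub>o opob T Y)"
    and chi_nat: "\<lbrakk>f \<in> Hom V X X'; g \<in> Hom V Y Y'\<rbrakk>
      \<Longrightarrow> chi T X' Y' \<cdot> opar T (f \<otimes> g) = (opar T f \<otimes> opar T g) \<cdot> chi T X Y"
    and theta_in: "theta T \<in> Hom V (opob T \<one>) \<one>"
    and chi_coassoc: "\<lbrakk>X \<in> Obj V; Y \<in> Obj V; Z \<in> Obj V\<rbrakk>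
      \<Longrightarrow> (chi T X Y \<otimes> Id V (opob T Z)) \<cdot> chi T (X \<otimes>\<^sub>o Y) Z
        = (Id V (opob T X) \<otimes> chi T Y Z) \<cdot> chi T X (Y \<otimes>\<^sub>o Z)"
    and chi_counit_left: "X \<in> Obj V
      \<Longrightarrow> (theta T \<otimes> Id V (opob T X)) \<cdot> chi T \<one> X = Id V (opob T X)"
    and chi_counit_right: "X \<in> Obj V
      \<Longrightarrow> (Id V (opob T X) \<otimes> theta T) \<cdot> chi T X \<one> = Id V (opob T X)"
    and chi_mult: "\<lbrakk>X \<in> Obj V; Y \<in> Obj V\<rbrakk>
      \<Longrightarrow> chi T X Y \<cdot> mult T (X \<otimes>\<^sub>o Y)
        = (mult T X \<otimes> mult T Y) \<cdot> chi T (opob T X) (opob T Y) \<cdot> opar T (chi T X Y)"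
    and theta_mult: "theta T \<cdot> mult T \<one> = theta T \<cdot> opar T (theta T)"
    and chi_munit: "\<lbrakk>X \<in> Obj V; Y \<in> Obj V\<rbrakk>
      \<Longrightarrow> chi T X Y \<cdot> munit T (X \<otimes>\<^sub>o Y) = munit T X \<otimes> munit T Y"
    and theta_munit: "theta T \<cdot> munit T \<one> = Id V \<one>"

text \<open>The domain of \<open>right_fusion_unit V T X\<close> is \<open>T (T X)\<close>, which is \<open>T (T X \<otimes> \<one>)\<close>
  by strictness.\<close>

definition right_fusion_unit ::
  "('o, 'a, 'z) moncat_scheme \<Rightarrow> ('o, 'a, 'y) opmonad_scheme \<Rightarrow> 'o \<Rightarrow> 'a" where
  "right_fusion_unit V T X =
     (mult T X \<otimes>\<^bsub>V\<^esub> Id V (opob T \<one>\<^bsub>V\<^esub>)) \<cdot>\<^bsub>V\<^esub> chi T (opob T X) \<one>\<^bsub>V\<^esub>"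

definition right_pre_Hopf ::
  "('o, 'a, 'z) moncat_scheme \<Rightarrow> ('o, 'a, 'y) opmonad_scheme \<Rightarrow> bool" where
  "right_pre_Hopf V T \<longleftrightarrow> (\<forall>X\<in>Obj V. iso V (right_fusion_unit V T X))"

section \<open>The comonad \<open>- \<otimes> T(\<one>)\<close>\<close>

record ('o, 'a) comonoid =
  cob :: "'o"
  ccomult :: "'a"
  ccounit :: "'a"

locale comonoid = strict_monoidal_category V
  for V :: "('o, 'a, 'z) moncat_scheme" (structure) and K :: "('o, 'a) comonoid" +
  assumes cob_in: "cob K \<in> Obj V"
    and ccomult_in: "ccomult K \<in> Hom V (cob K) (cob K \<otimes>\<^sub>o cob K)"
    and ccounit_in: "ccounit K \<in> Hom V (cob K) \<one>"
    and ccoassoc: "(ccomult K \<otimes> Id V (cob K)) \<cdot> ccomult K = (Id V (cob K) \<otimes> ccomult K) \<cdot> ccomult K"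
    and ccounit_left: "(ccounit K \<otimes> Id V (cob K)) \<cdot> ccomult K = Id V (cob K)"
    and ccounit_right: "(Id V (cob K) \<otimes> ccounit K) \<cdot> ccomult K = Id V (cob K)"

definition comonad_of_comonoid ::
  "('o, 'a, 'z) moncat_scheme \<Rightarrow> ('o, 'a) comonoid \<Rightarrow> ('o, 'a) comonad" where
  "comonad_of_comonoid V K =
     \<lparr>gfun = \<lparr>fob = (\<lambda>X. X \<otimes>\<^sub>o\<^bsub>V\<^esub> cob K), far = (\<lambda>f. f \<otimes>\<^bsub>V\<^esub> Id V (cob K))\<rparr>,
      comult = (\<lambda>X. Id V X \<otimes>\<^bsub>V\<^esub> ccomult K),
      counit = (\<lambda>X. Id V X \<otimes>\<^bsub>V\<^esub> ccounit K)\<rparr>"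

definition T_unit_comonoid ::
  "('o, 'a, 'z) moncat_scheme \<Rightarrow> ('o, 'a, 'y) opmonad_scheme \<Rightarrow> ('o, 'a) comonoid" where
  "T_unit_comonoid V T =
     \<lparr>cob = opob T \<one>\<^bsub>V\<^esub>, ccomult = chi T \<one>\<^bsub>V\<^esub> \<one>\<^bsub>V\<^esub>, ccounit = theta T\<rparr>"

definition T_unit_comonad ::
  "('o, 'a, 'z) moncat_scheme \<Rightarrow> ('o, 'a, 'y) opmonad_scheme \<Rightarrow> ('o, 'a) comonad" where
  "T_unit_comonad V T = comonad_of_comonoid V (T_unit_comonoid V T)"

lemma (in comonoid) comonad_of_comonoid: "comonad V (comonad_of_comonoid V K)"
proof -
  have A: "f \<in> Arr V" if "f \<in> Hom V X Y" for f X Y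
    using that by (simp add: Hom_def)
  have O: "X \<in> Obj V" "Y \<in> Obj V" if "f \<in> Hom V X Y" for f X Y
    using that Dom_in Cod_in by (auto simp: Hom_def)
  note K = cob_in ccomult_in ccounit_in Id_in[OF cob_in]
  show ?thesis
  proof (unfold_locales, goal_cases)
    case (1 X) then show ?case by (simp add: comonad_of_comonoid_def Tob_in K)
  next
    case (2 f X Y) then show ?case by (simp add: comonad_of_comonoid_def Tar_in K)
  next
    case (3 X) then show ?case by (simp add: comonad_of_comonoid_def Tar_Id K)
  next
    case (4 f X Y g Z)
    then show ?case
      using Tar_Comp[OF 4 K(4) K(4)] Comp_Id_left[OF K(4)] by (simp add: comonad_of_comonoid_def)
  next
    case 5
    have "Id V X \<otimes> ccomult K \<in> Hom V (X \<otimes>\<^sub>o cob K) ((X \<otimes>\<^sub>o cob K) \<otimes>\<^sub>o cob K)" if "X \<in> Obj V" for X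
      using Tar_in[OF Id_in[OF that] K(2)] that by (simp add: Tob_assoc K)
    moreover have "(Id V Y \<otimes> ccomult K) \<cdot> (f \<otimes> Id V (cob K))
        = ((f \<otimes> Id V (cob K)) \<otimes> Id V (cob K)) \<cdot> (Id V X \<otimes> ccomult K)"
      if f: "f \<in> Hom V X Y" for X Y f
    proof -
      have "(Id V Y \<otimes> ccomult K) \<cdot> (f \<otimes> Id V (cob K)) = (Id V Y \<cdot> f) \<otimes> (ccomult K \<cdot> Id V (cob K))"
        by (rule Tar_Comp[symmetric, OF f Id_in[OF O(2)[OF f]] K(4) K(2)])
      also have "\<dots> = (f \<cdot> Id V X) \<otimes> (Id V (cob K \<otimes>\<^sub>o cob K) \<cdot> ccomult K)"
        using f K by (simp add: Comp_Id_left Comp_Id_right[OF f] Comp_Id_right[OF K(2)] Comp_Id_left[OF K(2)])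
      also have "\<dots> = (f \<otimes> Id V (cob K \<otimes>\<^sub>o cob K)) \<cdot> (Id V X \<otimes> ccomult K)"
        by (rule Tar_Comp[OF Id_in[OF O(1)[OF f]] f K(2) Id_in[OF Tob_in[OF K(1) K(1)]]])
      finally show ?thesis
        by (simp add: Tar_assoc A[OF f] A[OF K(4)] Tar_Id K)
    qed
    ultimately show ?case
      by (simp add: nat_trans_def comonad_of_comonoid_def comp_ftor_def)
  next
    case 6
    have "Id V X \<otimes> ccounit K \<in> Hom V (X \<otimes>\<^sub>o cob K) X" if "X \<in> Obj V" for X
      using Tar_in[OF Id_in[OF that] K(3)] that by (simp add: Tob_Unit_right)
    moreover have "(Id V Y \<otimes> ccounit K) \<cdot> (f \<otimes> Id V (cob K)) = f \<cdot> (Id V X \<otimes> ccounit K)"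
      if f: "f \<in> Hom V X Y" for X Y f
    proof -
      have "(Id V Y \<otimes> ccounit K) \<cdot> (f \<otimes> Id V (cob K)) = (Id V Y \<cdot> f) \<otimes> (ccounit K \<cdot> Id V (cob K))"
        by (rule Tar_Comp[symmetric, OF f Id_in[OF O(2)[OF f]] K(4) K(3)])
      also have "\<dots> = (f \<cdot> Id V X) \<otimes> (Id V \<one> \<cdot> ccounit K)"
        by (simp add: Comp_Id_left[OF f] Comp_Id_right[OF f] Comp_Id_right[OF K(3)] Comp_Id_left[OF K(3)])
      also have "\<dots> = (f \<otimes> Id V \<one>) \<cdot> (Id V X \<otimes> ccounit K)"
        by (rule Tar_Comp[OF Id_in[OF O(1)[OF f]] f K(3) Id_in[OF Unit_in]])
      finally show ?thesis by (simp add: Tar_Unit_right A[OF f])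
    qed
    ultimately show ?case
      by (simp add: nat_trans_def comonad_of_comonoid_def id_ftor_def)
  next
    case (7 X)
    note I = Id_in[OF 7]
    have "((Id V X \<otimes> ccomult K) \<otimes> Id V (cob K)) \<cdot> (Id V X \<otimes> ccomult K)
        = Id V X \<otimes> ((ccomult K \<otimes> Id V (cob K)) \<cdot> ccomult K)"
      using Tar_Comp[OF I I K(2) Tar_in[OF K(2) K(4)]] 
      by (simp add: Tar_assoc A[OF I] A[OF K(2)] A[OF K(4)] Comp_Id_left[OF I])
    also have "\<dots> = (Id V (X \<otimes>\<^sub>o cob K) \<otimes> ccomult K) \<cdot> (Id V X \<otimes> ccomult K)"
      using Tar_Comp[OF I I K(2) Tar_in[OF K(4) K(2)]]
      by (simp add: ccoassoc Tar_assoc A[OF I] A[OF K(2)] A[OF K(4)] Comp_Id_left[OF I]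
          Tar_Id[OF 7 K(1), symmetric])
    finally show ?case by (simp add: comonad_of_comonoid_def)
  next
    case (8 X)
    note I = Id_in[OF 8]
    have "(Id V (X \<otimes>\<^sub>o cob K) \<otimes> ccounit K) \<cdot> (Id V X \<otimes> ccomult K)
        = Id V X \<otimes> ((Id V (cob K) \<otimes> ccounit K) \<cdot> ccomult K)"
      using Tar_Comp[OF I I K(2) Tar_in[OF K(4) K(3)]]
      by (simp only: Tar_Id[OF 8 K(1), symmetric] Tar_assoc[OF A[OF I] A[OF K(4)] A[OF K(3)]]
          Comp_Id_left[OF I])
    then show ?case by (simp add: comonad_of_comonoid_def ccounit_right Tar_Id[OF 8 K(1)])
  next
    case (9 X)
    note I = Id_in[OF 9]
    have "((Id V X \<otimes> ccounit K) \<otimes> Id V (cob K)) \<cdot> (Id V X \<otimes> ccomult K)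
        = Id V X \<otimes> ((ccounit K \<otimes> Id V (cob K)) \<cdot> ccomult K)"
      using Tar_Comp[OF I I K(2) Tar_in[OF K(3) K(4)]]
      by (simp only: Tar_assoc[OF A[OF I] A[OF K(3)] A[OF K(4)]] Comp_Id_left[OF I])
    then show ?case by (simp add: comonad_of_comonoid_def ccounit_left Tar_Id[OF 9 K(1)])
  qed
qed

lemma (in opmonoidal_monad) comonoid_T_unit: "comonoid V (T_unit_comonoid V T)"
  using fob_in[OF Unit_in] chi_in[OF Unit_in Unit_in] theta_in chi_coassoc[OF Unit_in Unit_in Unit_in]
    chi_counit_left[OF Unit_in] chi_counit_right[OF Unit_in]
  by unfold_locales (simp_all add: T_unit_comonoid_def Tob_Unit_left[OF Unit_in])

lemma (in opmonoidal_monad) comonad_T_unit: "comonad V (T_unit_comonad V T)"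
  unfolding T_unit_comonad_def by (rule comonoid.comonad_of_comonoid[OF comonoid_T_unit])

end

theory Submission
  imports Defs
begin

text \<open>Strictness turns \<open>\<chi>\<^sub>-\<^sub>,\<^sub>\<one>\<close> into a transformation \<open>T \<rightarrow> T(-) \<otimes> T(\<one>)\<close>, and the comodule axioms
  for it are instances of the opmonoidal axioms: counitality is the right counit law for \<open>\<theta>\<close>,
  and coassociativity is the coassociativity of \<open>\<chi>\<close> at \<open>X, \<one>, \<one>\<close>, since \<open>X \<otimes> \<one> = X\<close> and
  \<open>\<one> \<otimes> \<one> = \<one>\<close> (lemma \<open>left_comodule_structure_chi\<close>). So \<open>\<chi>\<^sub>-\<^sub>,\<^sub>\<one>\<close> is always a coaction.

  Its Galois map at \<open>X\<close> is \<open>(m\<^sub>X \<otimes> T(\<one>)) \<cdot> \<chi>\<^bsub>T(X),\<one>\<^esub>\<close>, which is literally the fusion morphism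
  that the right pre-Hopf condition asks to be invertible. What separates the two conditions is
  that one wants an inverse at each object and the other a natural inverse. The Galois map
  is natural in \<open>X\<close> (lemma \<open>nat_trans_galois_map\<close>), and pointwise inverses of a natural
  transformation assemble to a natural one (lemma \<open>nat_iso_iff_iso\<close>). Hence being right pre-Hopf
  is the same as being Galois via \<open>\<chi>\<^sub>-\<^sub>,\<^sub>\<one>\<close>, and this coaction witnesses the unspecified one
  in \<open>Galois\<close>.\<close>

context category
begin

lemma nat_transI:
  assumes "\<And>X. X \<in> Obj C \<Longrightarrow> \<tau> X \<in> Hom C (fob F X) (fob G X)"
    and "\<And>X Y f. f \<in> Hom C X Y \<Longrightarrow> \<tau> Y \<cdot> far F f = far G f \<cdot> \<tau> X"
  shows "nat_trans C F G \<tau>"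
  using assms by (simp add: nat_trans_def)

lemma nat_trans_in: "\<lbrakk>nat_trans C F G \<tau>; X \<in> Obj C\<rbrakk> \<Longrightarrow> \<tau> X \<in> Hom C (fob F X) (fob G X)"
  by (simp add: nat_trans_def)

lemma Hom_Obj: "f \<in> Hom C X Y \<Longrightarrow> X \<in> Obj C \<and> Y \<in> Obj C"
  using Dom_in Cod_in by (auto simp: Hom_def)

lemma nat_trans_square:
  "\<lbrakk>nat_trans C F G \<tau>; f \<in> Hom C X Y\<rbrakk> \<Longrightarrow> \<tau> Y \<cdot> far F f = far G f \<cdot> \<tau> X"
  using Hom_Obj by (simp add: nat_trans_def)

lemma iso_inverse:
  assumes "iso C f" and "f \<in> Hom C X Y"
  obtains g where "g \<in> Hom C Y X" "g \<cdot> f = Id C X" "f \<cdot> g = Id C Y"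
  using assms by (auto simp: iso_def Hom_def)

lemma endofunctor_comp:
  assumes "endofunctor C F" and "endofunctor C G"
  shows "endofunctor C (F \<circ>\<^sub>F G)"
proof -
  interpret F: endofunctor C F by fact
  interpret G: endofunctor C G by fact
  show ?thesis
    by unfold_locales (auto simp: comp_ftor_def F.far_Id G.far_Id G.far_Comp G.fob_in
        F.far_Comp[OF G.far_in G.far_in] intro: F.fob_in F.far_in G.far_in)
qed

lemma nat_trans_whisker_right:
  assumes "nat_trans C F G \<tau>" and "endofunctor C H"
  shows "nat_trans C (F \<circ>\<^sub>F H) (G \<circ>\<^sub>F H) (\<lambda>X. \<tau> (fob H X))"
proof -
  interpret H: endofunctor C H by fact
  show ?thesis
    using nat_trans_in[OF assms(1)] nat_trans_square[OF assms(1)]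
    by (intro nat_transI) (simp_all add: comp_ftor_def H.fob_in H.far_in)
qed

lemma nat_trans_whisker_left:
  assumes "nat_trans C F G \<tau>" and "endofunctor C F" and "endofunctor C G" and "endofunctor C H"
  shows "nat_trans C (H \<circ>\<^sub>F F) (H \<circ>\<^sub>F G) (\<lambda>X. far H (\<tau> X))"
proof -
  interpret F: endofunctor C F by fact
  interpret G: endofunctor C G by fact
  interpret H: endofunctor C H by fact
  show ?thesis
  proof (rule nat_transI)
    fix X assume "X \<in> Obj C"
    then show "far H (\<tau> X) \<in> Hom C (fob (H \<circ>\<^sub>F F) X) (fob (H \<circ>\<^sub>F G) X)"
      using nat_trans_in[OF assms(1)] by (simp add: comp_ftor_def H.far_in)
  next
    fix X Y f assume f: "f \<in> Hom C X Y"
    then have \<tau>: "\<tau> X \<in> Hom C (fob F X) (fob G X)" "\<tau> Y \<in> Hom C (fob F Y) (fob G Y)"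
      using nat_trans_in[OF assms(1)] Hom_Obj by auto
    have "far H (\<tau> Y) \<cdot> far H (far F f) = far H (far G f) \<cdot> far H (\<tau> X)"
      using nat_trans_square[OF assms(1) f]
        H.far_Comp[OF F.far_in[OF f] \<tau>(2)] H.far_Comp[OF \<tau>(1) G.far_in[OF f]] by simp
    then show "far H (\<tau> Y) \<cdot> far (H \<circ>\<^sub>F F) f = far (H \<circ>\<^sub>F G) f \<cdot> far H (\<tau> X)"
      by (simp add: comp_ftor_def)
  qed
qed

lemma nat_trans_vertical_comp:
  assumes \<sigma>: "nat_trans C F G \<sigma>" and \<tau>: "nat_trans C G H \<tau>"
    and "endofunctor C F" and "endofunctor C G" and "endofunctor C H"
  shows "nat_trans C F H (\<lambda>X. \<tau> X \<cdot> \<sigma> X)"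
proof -
  interpret F: endofunctor C F by fact
  interpret G: endofunctor C G by fact
  interpret H: endofunctor C H by fact
  show ?thesis
  proof (rule nat_transI)
    fix X assume "X \<in> Obj C"
    then show "\<tau> X \<cdot> \<sigma> X \<in> Hom C (fob F X) (fob H X)"
      using nat_trans_in[OF \<sigma>] nat_trans_in[OF \<tau>] Comp_in by blast
  next
    fix X Y f assume f: "f \<in> Hom C X Y"
    then have "X \<in> Obj C" "Y \<in> Obj C" using Hom_Obj by auto
    note s = this[THEN nat_trans_in[OF \<sigma>]] and t = this[THEN nat_trans_in[OF \<tau>]]
    have "(\<tau> Y \<cdot> \<sigma> Y) \<cdot> far F f = \<tau> Y \<cdot> (far G f \<cdot> \<sigma> X)"
      using Comp_assoc[OF F.far_in[OF f] s(2) t(2)] nat_trans_square[OF \<sigma> f] by simp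
    also have "\<dots> = (far H f \<cdot> \<tau> X) \<cdot> \<sigma> X"
      using Comp_assoc[OF s(1) G.far_in[OF f] t(2)] nat_trans_square[OF \<tau> f] by simp
    also have "\<dots> = far H f \<cdot> (\<tau> X \<cdot> \<sigma> X)"
      by (rule Comp_assoc[OF s(1) t(1) H.far_in[OF f]])
    finally show "(\<tau> Y \<cdot> \<sigma> Y) \<cdot> far F f = far H f \<cdot> (\<tau> X \<cdot> \<sigma> X)" .
  qed
qed

text \<open>Pointwise inverses are automatically natural: conjugating the naturality square of \<open>\<tau>\<close> at
  \<open>f\<close> by the inverses at its two ends gives the square for the inverses.\<close>

lemma nat_iso_iff_iso:
  assumes \<tau>: "nat_trans C F G \<tau>" and "endofunctor C F" and "endofunctor C G"
  shows "nat_iso C F G \<tau> \<longleftrightarrow> (\<forall>X\<in>Obj C. iso C (\<tau> X))"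
proof
  assume "nat_iso C F G \<tau>"
  then obtain \<sigma> where \<sigma>: "nat_trans C G F \<sigma>"
    and "\<forall>X\<in>Obj C. \<sigma> X \<cdot> \<tau> X = Id C (fob F X) \<and> \<tau> X \<cdot> \<sigma> X = Id C (fob G X)"
    by (auto simp: nat_iso_def)
  then show "\<forall>X\<in>Obj C. iso C (\<tau> X)"
    unfolding iso_def using nat_trans_in[OF \<tau>] nat_trans_in[OF \<sigma>] by blast
next
  assume isos: "\<forall>X\<in>Obj C. iso C (\<tau> X)"
  interpret F: endofunctor C F by fact
  interpret G: endofunctor C G by fact
  have "\<forall>X\<in>Obj C. \<exists>g. g \<in> Hom C (fob G X) (fob F X) \<and>
      g \<cdot> \<tau> X = Id C (fob F X) \<and> \<tau> X \<cdot> g = Id C (fob G X)"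
    using isos nat_trans_in[OF \<tau>] iso_inverse by metis
  then obtain \<sigma> where \<sigma>_in: "\<And>X. X \<in> Obj C \<Longrightarrow> \<sigma> X \<in> Hom C (fob G X) (fob F X)"
    and \<sigma>\<tau>: "\<And>X. X \<in> Obj C \<Longrightarrow> \<sigma> X \<cdot> \<tau> X = Id C (fob F X)"
    and \<tau>\<sigma>: "\<And>X. X \<in> Obj C \<Longrightarrow> \<tau> X \<cdot> \<sigma> X = Id C (fob G X)"
    by (metis (no_types, lifting))
  have "nat_trans C G F \<sigma>"
  proof (rule nat_transI[OF \<sigma>_in])
    fix X Y f assume f: "f \<in> Hom C X Y"
    then have XY: "X \<in> Obj C" "Y \<in> Obj C" using Hom_Obj by auto
    note s = XY[THEN \<sigma>_in] and t = XY[THEN nat_trans_in[OF \<tau>]]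
      and Ff = F.far_in[OF f] and Gf = G.far_in[OF f]
    have "\<sigma> Y \<cdot> far G f = \<sigma> Y \<cdot> (far G f \<cdot> (\<tau> X \<cdot> \<sigma> X))"
      by (simp add: \<tau>\<sigma> XY Comp_Id_right[OF Gf])
    also have "\<dots> = \<sigma> Y \<cdot> ((\<tau> Y \<cdot> far F f) \<cdot> \<sigma> X)"
      by (simp add: nat_trans_square[OF \<tau> f] Comp_assoc[OF s(1) t(1) Gf])
    also have "\<dots> = (\<sigma> Y \<cdot> \<tau> Y) \<cdot> (far F f \<cdot> \<sigma> X)"
      by (simp add: Comp_assoc[OF s(1) Ff t(2)]
          Comp_assoc[OF Comp_in[OF s(1) Ff] t(2) s(2)])
    also have "\<dots> = far F f \<cdot> \<sigma> X"
      by (simp add: \<sigma>\<tau> XY Comp_Id_left[OF Comp_in[OF s(1) Ff]])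
    finally show "\<sigma> Y \<cdot> far G f = far F f \<cdot> \<sigma> X" .
  qed
  then show "nat_iso C F G \<tau>"
    unfolding nat_iso_def using \<tau> \<sigma>\<tau> \<tau>\<sigma> by blast
qed

end

text \<open>The Galois map is the vertical composite of the two whiskerings \<open>\<beta>T\<close> and \<open>Gm\<close>; naturality
  is all that this uses, so \<open>\<beta>\<close> can be any transformation \<open>T \<rightarrow> GT\<close>.\<close>

lemma (in monad) nat_trans_galois_map:
  assumes G: "endofunctor C (gfun G)"
    and \<beta>: "nat_trans C (mfun M) (gfun G \<circ>\<^sub>F mfun M) \<beta>"
  shows "nat_trans C (mfun M \<circ>\<^sub>F mfun M) (gfun G \<circ>\<^sub>F mfun M) (galois_map C M G \<beta>)"
proof -
  have T: "endofunctor C (mfun M)" by (rule endofunctor_axioms)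
  note TT = endofunctor_comp[OF T T]
  have "nat_trans C (mfun M \<circ>\<^sub>F mfun M) (gfun G \<circ>\<^sub>F mfun M \<circ>\<^sub>F mfun M) (\<lambda>X. \<beta> (fob (mfun M) X))"
    using nat_trans_whisker_right[OF \<beta> T] by (simp add: comp_ftor_def)
  from nat_trans_vertical_comp[OF this nat_trans_whisker_left[OF mult_nat TT T G]
      TT endofunctor_comp[OF G TT] endofunctor_comp[OF G T]]
  show ?thesis
    by (simp add: galois_map_def[abs_def])
qed

context opmonoidal_monad
begin

text \<open>Each comodule law is the opmonoidal law of the same kind with the tensor unit in all
  arguments but the first; strictness then removes the units from the tensor products.\<close>

lemma left_comodule_structure_chi:
  "left_comodule_structure V (T_unit_comonad V T) (mfun T) (\<lambda>X. chi T X \<one>)"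
proof -
  have "nat_trans V (mfun T) (gfun (T_unit_comonad V T) \<circ>\<^sub>F mfun T) (\<lambda>X. chi T X \<one>)"
  proof (rule nat_transI)
    fix X assume "X \<in> Obj V"
    then show "chi T X \<one> \<in> Hom V (opob T X) (fob (gfun (T_unit_comonad V T) \<circ>\<^sub>F mfun T) X)"
      using chi_in[OF _ Unit_in] by (simp add: T_unit_comonad_def comonad_of_comonoid_def
          T_unit_comonoid_def comp_ftor_def Tob_Unit_right)
  next
    fix X Y f assume f: "f \<in> Hom V X Y"
    then have "f \<in> Arr V" by (simp add: Hom_def)
    then show "chi T Y \<one> \<cdot> opar T f = far (gfun (T_unit_comonad V T) \<circ>\<^sub>F mfun T) f \<cdot> chi T X \<one>"
      using chi_nat[OF f Id_in[OF Unit_in]] by (simp add: T_unit_comonad_def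
          comonad_of_comonoid_def T_unit_comonoid_def comp_ftor_def Tar_Unit_right far_Id Unit_in)
  qed
  moreover have "(Id V (opob T X) \<otimes> chi T \<one> \<one>) \<cdot> chi T X \<one>
      = (chi T X \<one> \<otimes> Id V (opob T \<one>)) \<cdot> chi T X \<one>" if "X \<in> Obj V" for X
    using chi_coassoc[OF that Unit_in Unit_in]
    by (simp add: Tob_Unit_right that Unit_in)
  ultimately show ?thesis
    by (simp add: left_comodule_structure_def T_unit_comonad_def comonad_of_comonoid_def
        T_unit_comonoid_def chi_counit_right)
qed

lemma galois_map_chi: "galois_map V T (T_unit_comonad V T) (\<lambda>X. chi T X \<one>) = right_fusion_unit V T"
  by (simp add: fun_eq_iff galois_map_def right_fusion_unit_def T_unit_comonad_def
      comonad_of_comonoid_def T_unit_comonoid_def)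

lemma right_pre_Hopf_iff_Galois_via_chi:
  "right_pre_Hopf V T \<longleftrightarrow> Galois_via V T (T_unit_comonad V T) (\<lambda>X. chi T X \<one>)"
proof -
  have T: "endofunctor V (mfun T)" by (rule endofunctor_axioms)
  have G: "endofunctor V (gfun (T_unit_comonad V T))"
    using comonad_T_unit by (rule comonad.axioms)
  have "nat_trans V (mfun T) (gfun (T_unit_comonad V T) \<circ>\<^sub>F mfun T) (\<lambda>X. chi T X \<one>)"
    using left_comodule_structure_chi by (simp add: left_comodule_structure_def)
  from nat_iso_iff_iso[OF nat_trans_galois_map[OF G this] endofunctor_comp[OF T T]
      endofunctor_comp[OF G T]]
  show ?thesis
    by (simp add: Galois_via_def left_comodule_structure_chi galois_map_chi right_pre_Hopf_def)
qed

end

theorem proposition3p6: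
  fixes V :: "('o, 'a) moncat" and T :: "('o, 'a) opmonad"
  assumes "opmonoidal_monad V T"
  shows "(right_pre_Hopf V T \<longleftrightarrow>
       Galois_via V T (T_unit_comonad V T) (\<lambda>X. chi T X \<one>\<^bsub>V\<^esub>)) \<and>
    (right_pre_Hopf V T \<longrightarrow> Galois V T (T_unit_comonad V T))"
  using opmonoidal_monad.right_pre_Hopf_iff_Galois_via_chi[OF assms] by (auto simp: Galois_def)

end
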